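(* There exists a set $E\subset\mathbb{R}$ (with the Euclidean metric) of zero length, i.e. of Lebesgue measure zero, whose conformal dimension equals $1$.
   Context: Given a homeomorphism $\eta:[0,\infty)\to[0,\infty)$, an embedding $f$ (a homeomorphism onto its image) from a metric space $(X,d_X)$ into a metric space $(Y,d_Y)$ is $\eta$-quasisymmetric if for all distinct triples $x,y,z\in X$ and all $t>0$, $\frac{d_X(x,y)}{d_X(y,z)}\le t$ implies $\frac{d_Y(f(x),f(y))}{d_Y(f(y),f(z))}\le \eta(t)$. It is quasisymmetric if it is $\eta$-quasisymmetric for some $\eta$. The conformal dimension of a metric space $X$ is the infimum of the Hausdorff dimensions $\dim_H f(X)$ over all quasisymmetric maps $f$ defined on $X$ (with values in arbitrary metric spaces). *)

theory Defs
  imports "HOL-Analysis.Analysis"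
begin

definition mdiam :: "'a metric \<Rightarrow> 'a set \<Rightarrow> ennreal" where
  "mdiam m U = (SUP x\<in>U. SUP y\<in>U. ennreal (mdist m x y))"

text \<open>Only exponents \<open>s > 0\<close> are used below, so the value of \<open>0 powr 0\<close> is irrelevant.
  The diameters are at most \<open>\<delta>\<close>, hence finite, so that \<open>enn2real\<close> loses nothing.\<close>

definition hausdorff_premeasure :: "'a metric \<Rightarrow> real \<Rightarrow> real \<Rightarrow> 'a set \<Rightarrow> ennreal" where
  "hausdorff_premeasure m s \<delta> A =
     (INF U \<in> {U :: nat \<Rightarrow> 'a set. (\<forall>i. U i \<subseteq> mspace m \<and> mdiam m (U i) \<le> ennreal \<delta>) \<and> A \<subseteq> (\<Union>i. U i)}.
        \<Sum>i. ennreal (enn2real (mdiam m (U i)) powr s))"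

definition hausdorff_measure :: "'a metric \<Rightarrow> real \<Rightarrow> 'a set \<Rightarrow> ennreal" where
  "hausdorff_measure m s A = (SUP \<delta>\<in>{0<..}. hausdorff_premeasure m s \<delta> A)"

definition hausdorff_dim :: "'a metric \<Rightarrow> 'a set \<Rightarrow> ennreal" where
  "hausdorff_dim m A = Inf {ennreal s |s. 0 < s \<and> hausdorff_measure m s A = 0}"

definition eta_quasisymmetric ::
    "(real \<Rightarrow> real) \<Rightarrow> 'a metric \<Rightarrow> 'b metric \<Rightarrow> ('a \<Rightarrow> 'b) \<Rightarrow> bool" where
  "eta_quasisymmetric \<eta> m m' f \<longleftrightarrow>
     embedding_map (mtopology_of m) (mtopology_of m') f \<and>
     (\<forall>x\<in>mspace m. \<forall>y\<in>mspace m. \<forall>z\<in>mspace m. x \<noteq> y \<and> y \<noteq> z \<and> x \<noteq> z \<longrightarrow>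
        (\<forall>t>0. mdist m x y / mdist m y z \<le> t \<longrightarrow>
           mdist m' (f x) (f y) / mdist m' (f y) (f z) \<le> \<eta> t))"

definition quasisymmetric :: "'a metric \<Rightarrow> 'b metric \<Rightarrow> ('a \<Rightarrow> 'b) \<Rightarrow> bool" where
  "quasisymmetric m m' f \<longleftrightarrow>
     (\<exists>\<eta>. homeomorphic_map (top_of_set {0..}) (top_of_set {0..}) \<eta> \<and> eta_quasisymmetric \<eta> m m' f)"

text \<open>HOL cannot quantify over the type of the target space inside a definition, so the targets
  range over all metrics, on arbitrary carriers, in the point type of the source. This
  loses nothing, because the metric of any image \<open>f X\<close> can be pulled back to \<open>X\<close>; the lemma
  \<open>conformal_dim_le\<close> below shows that targets of every other type are accounted for.\<close>

definition conformal_dim :: "'a metric \<Rightarrow> ennreal" where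
  "conformal_dim m =
     Inf {hausdorff_dim m' (f ` mspace m) |(m' :: 'a metric) (f :: 'a \<Rightarrow> 'a). quasisymmetric m m' f}"

lemma conformal_dim_le:
  fixes m :: "'a metric" and m' :: "'b metric" and f :: "'a \<Rightarrow> 'b"
  assumes "quasisymmetric m m' f"
  shows "conformal_dim m \<le> hausdorff_dim m' (f ` mspace m)"
proof -
  define X where "X = mspace m"
  define d where "d = (\<lambda>x y. mdist m' (f x) (f y))"
  obtain \<eta> where \<eta>: "homeomorphic_map (top_of_set {0..}) (top_of_set {0..}) \<eta>"
    and qs: "eta_quasisymmetric \<eta> m m' f"
    using assms by (auto simp: quasisymmetric_def)
  have emb: "embedding_map (mtopology_of m) (mtopology_of m') f"
    using qs by (simp add: eta_quasisymmetric_def)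
  then have hom: "homeomorphic_map (mtopology_of m) (subtopology (mtopology_of m') (f ` X)) f"
    by (simp add: embedding_map_def X_def)
  then have inj: "inj_on f X"
    by (metis X_def homeomorphic_imp_injective_map topspace_mtopology_of)
  have fX: "f ` X \<subseteq> mspace m'"
    using homeomorphic_imp_surjective_map[OF hom] unfolding topspace_subtopology topspace_mtopology_of X_def
    by blast
  interpret M': Metric_space "mspace m'" "mdist m'" by simp
  interpret M: Metric_space X d
  proof
    show "0 \<le> d x y" "d x y = d y x" for x y
      by (simp_all add: d_def mdist_commute)
    show "(d x y = 0) = (x = y)" if "x \<in> X" "y \<in> X" for x y
      using that fX inj_on_eq_iff[OF inj] M'.zero[of "f x" "f y"] by (simp add: d_def image_subset_iff)
    show "d x z \<le> d x y + d y z" if "x \<in> X" "y \<in> X" "z \<in> X" for x y z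
      using that fX by (auto simp: d_def intro!: M'.triangle)
  qed
  define n where "n = metric (X, d)"
  have n: "mspace n = X" "mdist n = d" "mtopology_of n = M.mtopology"
    by (simp_all add: n_def M.Metric_space_axioms)
  interpret MM: Metric_space12 X d "mspace m'" "mdist m'" ..
  have "embedding_map M.mtopology M'.mtopology f"
    using fX by (intro MM.isometry_imp_embedding_map) (auto simp: d_def)
  then have hom2: "homeomorphic_map (mtopology_of n) (subtopology (mtopology_of m') (f ` X)) f"
    by (simp add: embedding_map_def n mtopology_of_def)
  then obtain g where g: "homeomorphic_maps (mtopology_of n) (subtopology (mtopology_of m') (f ` X)) f g"
    using homeomorphic_map_maps by blast
  have "homeomorphic_map (mtopology_of m) (mtopology_of n) (g \<circ> f)"
    using g hom homeomorphic_map_compose homeomorphic_maps_map by blast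
  moreover have "(g \<circ> f) x = id x" if "x \<in> topspace (mtopology_of m)" for x
    using g that topspace_mtopology_of[of n] n(1) unfolding homeomorphic_maps_def
    by (simp add: X_def)
  ultimately have "homeomorphic_map (mtopology_of m) (mtopology_of n) id"
    using homeomorphic_map_eq by blast
  then have "embedding_map (mtopology_of m) (mtopology_of n) id"
    using topspace_mtopology_of[of n] n(1) subtopology_topspace[of "mtopology_of n"]
    by (simp add: embedding_map_def X_def)
  then have "eta_quasisymmetric \<eta> m n id"
    using qs by (simp add: eta_quasisymmetric_def n d_def)
  then have "quasisymmetric m n id"
    using \<eta> by (auto simp: quasisymmetric_def)
  then have "conformal_dim m \<le> hausdorff_dim n (id ` mspace m)"
    unfolding conformal_dim_def by (intro Inf_lower) blast
  also have "\<dots> = hausdorff_dim n X"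
    by (simp add: X_def)
  also have "\<dots> \<le> hausdorff_dim m' (f ` X)"
  proof -
    have pre: "hausdorff_premeasure n s \<delta> X \<le> hausdorff_premeasure m' s \<delta> (f ` X)" if s: "s > 0" for s \<delta>
      unfolding hausdorff_premeasure_def
    proof (rule INF_greatest)
      fix U :: "nat \<Rightarrow> 'b set"
      assume "U \<in> {U. (\<forall>i. U i \<subseteq> mspace m' \<and> mdiam m' (U i) \<le> ennreal \<delta>) \<and> f ` X \<subseteq> (\<Union>i. U i)}"
      then have U: "mdiam m' (U i) \<le> ennreal \<delta>" "f ` X \<subseteq> (\<Union>i. U i)" for i
        by auto
      define V where "V i = X \<inter> f -` U i" for i
      have VU: "mdiam n (V i) \<le> mdiam m' (U i)" for i
        unfolding mdiam_def n d_def
        by (auto intro!: SUP_least intro: SUP_upper2 simp: V_def)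
      have fin: "mdiam m' (U i) < top" for i
        using U(1)[of i] by (metis ennreal_less_top le_less_trans)
      have "(\<Sum>i. ennreal (enn2real (mdiam n (V i)) powr s))
          \<le> (\<Sum>i. ennreal (enn2real (mdiam m' (U i)) powr s))"
        using s by (intro suminf_le ennreal_leI powr_mono2 enn2real_mono VU fin) auto
      moreover have "V \<in> {V. (\<forall>i. V i \<subseteq> mspace n \<and> mdiam n (V i) \<le> ennreal \<delta>) \<and> X \<subseteq> (\<Union>i. V i)}"
        using order_trans[OF VU U(1)] U(2) by (simp add: V_def n) blast
      ultimately show "(INF V\<in>{V. (\<forall>i. V i \<subseteq> mspace n \<and> mdiam n (V i) \<le> ennreal \<delta>) \<and> X \<subseteq> (\<Union>i. V i)}.
          \<Sum>i. ennreal (enn2real (mdiam n (V i)) powr s))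
          \<le> (\<Sum>i. ennreal (enn2real (mdiam m' (U i)) powr s))"
        by (rule INF_lower2[rotated])
    qed
    have "hausdorff_measure n s X \<le> hausdorff_measure m' s (f ` X)" if "s > 0" for s
      unfolding hausdorff_measure_def using pre[OF that] by (intro SUP_mono) auto
    then show ?thesis
      unfolding hausdorff_dim_def by (intro Inf_superset_mono) (use le_zero_eq in fastforce)
  qed
  finally show ?thesis by (simp add: X_def)
qed

end

theory Submission
  imports Defs "HOL-Library.Sublist"
begin

text \<open>
  The set is a countable union of self-similar Cantor sets, the \<open>M\<close>-th one consisting of the points
  of \<open>[0, 1]\<close> whose base \<open>2M\<close> expansion uses the digits \<open>0, 2, \<dots>, 2M - 2\<close>. Each of them has length
  zero, and the identity map shows that the conformal dimension of the union is at most \<open>1\<close>. It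
  remains to see that a quasisymmetric image of the union has nonzero \<open>s\<close>-dimensional measure for
  every \<open>s < 1\<close>.

  Fix the map and \<open>s\<close>, let \<open>d\<close> be the pulled back metric, and let the width \<open>W\<close> of a cylinder be the
  \<open>d\<close>-distance of its end points. The gaps between the \<open>M\<close> children of a cylinder are comparable to
  the children, so the triangle inequality bounds the width of the cylinder by \<open>K\<close> times the sum of
  the widths of its children, with \<open>K\<close> independent of \<open>M\<close> (\<open>width_le_sum_children\<close>). On the other hand
  each child is about \<open>2M\<close> times shorter than its parent, so its width is at most \<open>\<delta>\<close> times that of
  the parent, with \<open>\<delta>\<close> tending to \<open>0\<close> as \<open>M\<close> grows (\<open>width_child_le\<close>). As \<open>s < 1\<close>, the smallness of the
  children pays for the constant: for large \<open>M\<close> the power \<open>W\<^sup>s\<close> of a cylinder is at most the sum of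
  those of its children (\<open>powr_subadditive_from_fine_split\<close>).

  A weight of this kind gives every countable cover by cylinders at least the weight of the whole
  set (\<open>word_cover_sum_ge\<close>). Finally a general cover is no better than a cover by cylinders, since
  every set lies, as far as it meets the Cantor set, in one cylinder whose width is at most a
  constant times its diameter, or arbitrarily small (\<open>cylinder_hull\<close>).
\<close>

section \<open>Cantor sets with even digits\<close>

definition digit_seqs :: "nat \<Rightarrow> (nat \<Rightarrow> nat) set" where
  "digit_seqs M = {a. \<forall>i. a i < M}"

text \<open>In base \<open>2M\<close> only the even digits \<open>2k\<close> with \<open>k < M\<close> are used, so neighbouring pieces of a given
  level are separated by a gap about as long as the pieces themselves. A sequence records the halved
  digits.\<close>

definition digit_point :: "nat \<Rightarrow> (nat \<Rightarrow> nat) \<Rightarrow> real" where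
  "digit_point M a = (\<Sum>i. 2 * real (a i) / (2 * real M) ^ Suc i)"

definition cantor :: "nat \<Rightarrow> real set" where
  "cantor M = digit_point M ` digit_seqs M"

text \<open>The similarity that prefixes the (halved) digits of the word to the expansion of \<open>x\<close>. The image
  of \<open>cantor M\<close> under it is the cylinder of the word, and the images of \<open>0\<close> and of the largest
  point \<open>cantor_max M\<close> are the end points of the cylinder.\<close>

primrec word_map :: "nat \<Rightarrow> nat list \<Rightarrow> real \<Rightarrow> real" where
  "word_map M [] x = x"
| "word_map M (k # w) x = (2 * real k + word_map M w x) / (2 * real M)"

definition cantor_max :: "nat \<Rightarrow> real" where
  "cantor_max M = (2 * real M - 2) / (2 * real M - 1)"

lemma digit_seqs_shift: "a \<in> digit_seqs M \<Longrightarrow> (\<lambda>i. a (i + n)) \<in> digit_seqs M"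
  by (simp add: digit_seqs_def)

lemma word_map_append: "word_map M (u @ v) x = word_map M u (word_map M v x)"
  by (induction u) simp_all

lemma word_map_diff: "word_map M w x - word_map M w y = (x - y) / (2 * real M) ^ length w"
proof (induction w)
  case (Cons k w)
  have "word_map M (k # w) x - word_map M (k # w) y
      = (word_map M w x - word_map M w y) / (2 * real M)"
    by (simp add: diff_divide_distrib[symmetric])
  then show ?case
    using Cons by (simp add: field_simps)
qed simp

locale cantor_set =
  fixes M :: nat
  assumes M: "2 \<le> M"
begin

text \<open>The geometric series with every digit maximal. It majorises all the expansions and
  evaluates the largest point of the set.\<close>

lemma max_digit_sums: "(\<lambda>i. (2 * real M - 2) / (2 * real M) ^ Suc i) sums cantor_max M"
proof -
  have "(\<lambda>i. (1 / (2 * real M)) ^ i) sums (1 / (1 - 1 / (2 * real M)))"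
    using M by (intro geometric_sums) auto
  from sums_mult[OF this, of "(2 * real M - 2) / (2 * real M)"]
  have "(\<lambda>i. (2 * real M - 2) / (2 * real M) ^ Suc i) sums
      ((2 * real M - 2) / (2 * real M) * (1 / (1 - 1 / (2 * real M))))"
    by (simp add: power_divide mult.commute)
  also have "(2 * real M - 2) / (2 * real M) * (1 / (1 - 1 / (2 * real M))) = cantor_max M"
    using M by (simp add: cantor_max_def divide_simps)
  finally show ?thesis .
qed

lemma cantor_max_bounds: "2 / 3 \<le> cantor_max M" "cantor_max M \<le> 1"
  using M by (auto simp: cantor_max_def divide_simps)

lemma digit_term_le:
  assumes "a \<in> digit_seqs M"
  shows "2 * real (a i) / (2 * real M) ^ Suc i \<le> (2 * real M - 2) / (2 * real M) ^ Suc i"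
proof -
  have "a i < M" using assms by (simp add: digit_seqs_def)
  then have "2 * real (a i) \<le> 2 * real M - 2" by linarith
  then show ?thesis by (intro divide_right_mono) auto
qed

lemma digit_point_summable:
  assumes "a \<in> digit_seqs M"
  shows "summable (\<lambda>i. 2 * real (a i) / (2 * real M) ^ Suc i)"
  by (rule summable_comparison_test'[OF sums_summable[OF max_digit_sums], of 0])
     (use digit_term_le[OF assms] in auto)

lemma digit_point_bounds:
  assumes "a \<in> digit_seqs M"
  shows "0 \<le> digit_point M a" "digit_point M a \<le> 1"
proof -
  show "0 \<le> digit_point M a"
    unfolding digit_point_def by (intro suminf_nonneg digit_point_summable assms) simp
  have "digit_point M a \<le> cantor_max M"
    unfolding digit_point_def sums_unique[OF max_digit_sums]
    by (intro suminf_le digit_term_le assms digit_point_summable sums_summable[OF max_digit_sums])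
  then show "digit_point M a \<le> 1"
    using cantor_max_bounds by linarith
qed

lemma digit_point_Cons:
  assumes "a \<in> digit_seqs M"
  shows "digit_point M a = (2 * real (a 0) + digit_point M (\<lambda>i. a (Suc i))) / (2 * real M)"
proof -
  let ?t = "\<lambda>a i. 2 * real (a i) / (2 * real M) ^ Suc i"
  have "digit_point M a = ?t a 0 + (\<Sum>i. ?t a (Suc i))"
    unfolding digit_point_def
    using suminf_split_initial_segment[OF digit_point_summable[OF assms], of 1] by simp
  also have "(\<lambda>i. ?t a (Suc i)) = (\<lambda>i. ?t (\<lambda>i. a (Suc i)) i / (2 * real M))"
    by (simp add: fun_eq_iff)
  also have "(\<Sum>i. ?t (\<lambda>i. a (Suc i)) i / (2 * real M))
      = digit_point M (\<lambda>i. a (Suc i)) / (2 * real M)"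
    unfolding digit_point_def
    using digit_point_summable[OF digit_seqs_shift[OF assms, of 1]]
    by (intro suminf_divide) simp
  finally show ?thesis
    by (simp add: add_divide_distrib)
qed

lemma digit_point_word:
  assumes "a \<in> digit_seqs M"
  shows "digit_point M a = word_map M (map a [0..<n]) (digit_point M (\<lambda>i. a (i + n)))"
  using assms
proof (induction n arbitrary: a)
  case (Suc n)
  have "map a [0..<Suc n] = a 0 # map (\<lambda>i. a (Suc i)) [0..<n]"
    by (simp add: map_upt_Suc del: upt_Suc)
  then show ?case
    using digit_point_Cons[OF Suc.prems] Suc.IH[OF digit_seqs_shift[OF Suc.prems, of 1]]
    by (simp del: upt_Suc)
qed simp

lemma zero_in_cantor: "0 \<in> cantor M"
proof -
  have "(\<lambda>_. 0) \<in> digit_seqs M" using M by (simp add: digit_seqs_def)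
  moreover have "digit_point M (\<lambda>_. 0) = 0" by (simp add: digit_point_def)
  ultimately show ?thesis unfolding cantor_def by (metis imageI)
qed

lemma cantor_max_in_cantor: "cantor_max M \<in> cantor M"
proof -
  have "(\<lambda>_. M - 1) \<in> digit_seqs M" using M by (simp add: digit_seqs_def)
  moreover have "digit_point M (\<lambda>_. M - 1) = cantor_max M"
    using sums_unique[OF max_digit_sums] M
    by (simp add: digit_point_def of_nat_diff right_diff_distrib)
  ultimately show ?thesis unfolding cantor_def by (metis imageI)
qed

lemma word_map_in_cantor:
  assumes "x \<in> cantor M" "set w \<subseteq> {..<M}"
  shows "word_map M w x \<in> cantor M"
  using assms(2)
proof (induction w)
  case (Cons k w)
  then obtain a where a: "a \<in> digit_seqs M" "word_map M w x = digit_point M a"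
    by (auto simp: cantor_def)
  define b where "b = case_nat k a"
  have b: "b \<in> digit_seqs M"
    using a(1) Cons.prems by (auto simp: b_def digit_seqs_def split: nat.split)
  have "digit_point M b = word_map M (k # w) x"
    using digit_point_Cons[OF b] a(2) by (simp add: b_def)
  then show ?case using b unfolding cantor_def by (metis imageI)
qed (use assms in simp)

lemma cantor_subset: "cantor M \<subseteq> {0..1}"
  using digit_point_bounds by (auto simp: cantor_def)

text \<open>Even digits differ by at least \<open>2\<close>, whereas the tails that follow them differ by at most \<open>1\<close>.\<close>

lemma digit_point_separation:
  assumes a: "a \<in> digit_seqs M" and b: "b \<in> digit_seqs M"
    and eq: "map a [0..<n] = map b [0..<n]" and ne: "a n \<noteq> b n"
  shows "1 / (2 * real M) ^ Suc n \<le> \<bar>digit_point M a - digit_point M b\<bar>"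
proof -
  let ?tail = "\<lambda>a n. digit_point M (\<lambda>i. a (i + n))"
  have "digit_point M a - digit_point M b = (?tail a n - ?tail b n) / (2 * real M) ^ n"
    using digit_point_word[OF a, of n] digit_point_word[OF b, of n] word_map_diff eq by simp
  moreover have "?tail a n - ?tail b n
      = (2 * (real (a n) - real (b n)) + (?tail a (Suc n) - ?tail b (Suc n))) / (2 * real M)"
    using digit_point_Cons[OF digit_seqs_shift[OF a, of n]]
      digit_point_Cons[OF digit_seqs_shift[OF b, of n]]
    by (simp add: diff_divide_distrib add_divide_distrib)
  ultimately have eq: "\<bar>digit_point M a - digit_point M b\<bar>
      = \<bar>2 * (real (a n) - real (b n)) + (?tail a (Suc n) - ?tail b (Suc n))\<bar> / (2 * real M) ^ Suc n"
    by (simp add: abs_divide mult.commute)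
  have "1 \<le> \<bar>real (a n) - real (b n)\<bar>" using ne by linarith
  moreover have "\<bar>?tail a (Suc n) - ?tail b (Suc n)\<bar> \<le> 1"
    using digit_point_bounds[OF digit_seqs_shift[OF a, of "Suc n"]]
      digit_point_bounds[OF digit_seqs_shift[OF b, of "Suc n"]] by linarith
  moreover have "1 \<le> \<bar>2 * u + v\<bar>" if "1 \<le> \<bar>u\<bar>" "\<bar>v\<bar> \<le> 1" for u v :: real
    using that by linarith
  ultimately have "1 \<le> \<bar>2 * (real (a n) - real (b n)) + (?tail a (Suc n) - ?tail b (Suc n))\<bar>"
    by blast
  then show ?thesis
    unfolding eq by (intro divide_right_mono) auto
qed

text \<open>The usual decreasing closed sets whose intersection is the Cantor set: \<open>M\<close> copies of the previous
  one, each scaled by \<open>1 / (2M)\<close>, so that the length is halved at every step.\<close>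

primrec stage :: "nat \<Rightarrow> real set" where
  "stage 0 = {0..1}"
| "stage (Suc n) = (\<Union>k<M. (\<lambda>x. (1 / (2 * real M)) *\<^sub>R x + real k / real M) ` stage n)"

lemma compact_stage: "compact (stage n)"
proof (induction n)
  case (Suc n)
  then show ?case
    using M unfolding stage.simps by (intro compact_UN compact_continuous_image continuous_intros) auto
qed simp

lemma emeasure_stage: "emeasure lebesgue (stage n) \<le> ennreal ((1 / 2) ^ n)"
proof (induction n)
  case (Suc n)
  have meas: "(\<lambda>x. (1 / (2 * real M)) *\<^sub>R x + real k / real M) ` stage n \<in> sets lebesgue" for k
    using M by (intro sets_completionI_sets) (auto intro!: borel_compact compact_continuous_image continuous_intros compact_stage)
  have "emeasure lebesgue (stage (Suc n))
      \<le> (\<Sum>k<M. emeasure lebesgue ((\<lambda>x. (1 / (2 * real M)) *\<^sub>R x + real k / real M) ` stage n))"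
    unfolding stage.simps using meas by (intro emeasure_subadditive_finite) blast+
  also have "\<dots> = (\<Sum>k<M. ennreal (1 / (2 * real M)) * emeasure lebesgue (stage n))"
    by (subst emeasure_lebesgue_affine) simp
  also have "\<dots> \<le> (\<Sum>k<M. ennreal (1 / (2 * real M)) * ennreal ((1 / 2) ^ n))"
    by (intro sum_mono mult_left_mono Suc) auto
  also have "\<dots> = (\<Sum>k<M. ennreal (1 / (2 * real M) * (1 / 2) ^ n))"
    by (intro sum.cong refl ennreal_mult[symmetric]) auto
  also have "\<dots> = ennreal (\<Sum>k<M. 1 / (2 * real M) * (1 / 2) ^ n)"
    by (intro sum_ennreal) simp
  also have "(\<Sum>k<M. 1 / (2 * real M) * (1 / 2) ^ n) = (1 / 2) ^ Suc n"
    using M by (simp add: field_simps)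
  finally show ?case .
qed simp

lemma digit_point_in_stage:
  assumes "a \<in> digit_seqs M"
  shows "digit_point M a \<in> stage n"
  using assms
proof (induction n arbitrary: a)
  case 0
  then show ?case using digit_point_bounds by simp
next
  case (Suc n)
  have "digit_point M (\<lambda>i. a (Suc i)) \<in> stage n"
    using Suc.IH[OF digit_seqs_shift[OF Suc.prems, of 1]] by simp
  moreover have "digit_point M a
      = (1 / (2 * real M)) *\<^sub>R digit_point M (\<lambda>i. a (Suc i)) + real (a 0) / real M"
    using digit_point_Cons[OF Suc.prems] M by (simp add: field_simps)
  moreover have "a 0 < M" using Suc.prems by (simp add: digit_seqs_def)
  ultimately show ?case by auto
qed

lemma null_cantor: "cantor M \<in> null_sets lebesgue"
proof -
  have meas: "stage n \<in> sets lebesgue" for n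
    by (intro sets_completionI_sets) (simp add: borel_compact compact_stage)
  define K where "K = (\<Inter>n. stage n)"
  have [measurable]: "K \<in> sets lebesgue" unfolding K_def using meas by auto
  have "emeasure lebesgue K \<le> ennreal ((1 / 2) ^ n)" for n
    by (rule order_trans[OF emeasure_mono emeasure_stage]) (auto simp: K_def meas)
  moreover have "(\<lambda>n. ennreal ((1 / 2) ^ n)) \<longlonglongrightarrow> ennreal 0"
    by (intro tendsto_ennrealI LIMSEQ_power_zero) simp
  ultimately have "emeasure lebesgue K \<le> ennreal 0"
    by (intro LIMSEQ_le_const) auto
  then have "K \<in> null_sets lebesgue" by (intro null_setsI) auto
  moreover have "cantor M \<subseteq> K"
    using digit_point_in_stage by (auto simp: K_def cantor_def)
  ultimately show ?thesis by (rule null_sets_completion_subset[rotated])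
qed

end

section \<open>Weights on the tree of words\<close>

text \<open>A weight on words which never exceeds the total weight of the one-letter extensions cannot be
  undercut by a countable family of cylinders that meets every infinite branch. Otherwise the root
  weighs more than all members of the family below it; this deficit is inherited by some child of any
  word that has it, and descending forever gives a branch all of whose prefixes have a deficit. The
  branch passes through a member of the family, which alone weighs as much as itself. This plays the
  role of the mass distribution principle.\<close>

lemma word_cover_sum_ge:
  fixes W :: "nat list \<Rightarrow> ennreal" and c :: "nat \<Rightarrow> nat list"
  assumes sub: "\<And>w. set w \<subseteq> {..<M} \<Longrightarrow> W w \<le> (\<Sum>k<M. W (w @ [k]))"
    and cover: "\<And>a. a \<in> digit_seqs M \<Longrightarrow> \<exists>i n. map a [0..<n] = c i"
  shows "W [] \<le> (\<Sum>i. W (c i))"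
proof (rule ccontr)
  define S where "S w = (\<Sum>i. if prefix w (c i) then W (c i) else 0)" for w
  assume "\<not> W [] \<le> (\<Sum>i. W (c i))"
  then have start: "S [] < W []"
    by (simp add: S_def)
  have step: "\<exists>k<M. S (w @ [k]) < W (w @ [k])" if w: "set w \<subseteq> {..<M}" and less: "S w < W w" for w
  proof (rule ccontr)
    assume "\<not> (\<exists>k<M. S (w @ [k]) < W (w @ [k]))"
    then have "(\<Sum>k<M. W (w @ [k])) \<le> (\<Sum>k<M. S (w @ [k]))"
      by (intro sum_mono) (use leI in blast)
    also have "\<dots> = (\<Sum>i. \<Sum>k<M. if prefix (w @ [k]) (c i) then W (c i) else 0)"
      unfolding S_def by (intro suminf_sum[symmetric]) simp
    also have "\<dots> \<le> S w"
      unfolding S_def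
    proof (intro suminf_le)
      fix i
      show "(\<Sum>k<M. if prefix (w @ [k]) (c i) then W (c i) else 0)
          \<le> (if prefix w (c i) then W (c i) else 0)"
      proof (cases "\<exists>k. prefix (w @ [k]) (c i)")
        case True
        then obtain k v where k: "c i = w @ k # v" by (auto simp: prefix_def)
        have "(\<Sum>j<M. if prefix (w @ [j]) (c i) then W (c i) else 0)
            = (\<Sum>j<M. if j = k then W (c i) else 0)"
          by (intro sum.cong) (auto simp: k)
        also have "\<dots> \<le> W (c i)" by simp
        finally show ?thesis by (simp add: k)
      qed simp
    qed simp_all
    finally show False using sub[OF w] less by simp
  qed
  define next_digit where "next_digit w = (SOME k. k < M \<and> S (w @ [k]) < W (w @ [k]))" for w
  define branch where "branch = rec_nat [] (\<lambda>_ w. w @ [next_digit w])"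
  have branch_Suc: "branch (Suc n) = branch n @ [next_digit (branch n)]" for n
    by (simp add: branch_def)
  have branch: "set (branch n) \<subseteq> {..<M} \<and> S (branch n) < W (branch n)" for n
  proof (induction n)
    case 0
    then show ?case using start by (simp add: branch_def)
  next
    case (Suc n)
    then have "next_digit (branch n) < M \<and> S (branch (Suc n)) < W (branch (Suc n))"
      using someI_ex[OF step[of "branch n"]] by (simp add: branch_Suc next_digit_def)
    then show ?case using Suc by (simp add: branch_Suc)
  qed
  define a where "a n = next_digit (branch n)" for n
  have prefixes: "map a [0..<n] = branch n" for n
    by (induction n) (simp_all add: a_def branch_Suc, simp add: branch_def)
  have "a n < M" for n
    using branch[of "Suc n"] by (simp add: a_def branch_Suc)
  then obtain i n where i: "branch n = c i"
    using cover[of a] by (auto simp: digit_seqs_def prefixes)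
  have "W (c i) \<le> S (branch n)"
  proof -
    have "(\<Sum>j\<in>{i}. if prefix (branch n) (c j) then W (c j) else 0) \<le> S (branch n)"
      unfolding S_def by (intro sum_le_suminf) auto
    then show ?thesis by (simp add: i)
  qed
  then show False using branch[of n] i by (metis leD)
qed

section \<open>Distortion control of quasisymmetric maps\<close>

text \<open>An injective continuous function on an interval is monotone, so the zero of \<open>\<eta>\<close> cannot lie in the
  interior of the half-line, where it would force a negative value on one side. Hence \<open>\<eta> 0 = 0\<close>, and
  \<open>\<eta>\<close> is small near \<open>0\<close>.\<close>

lemma
  fixes \<eta> :: "real \<Rightarrow> real"
  assumes hom: "homeomorphic_map (top_of_set {0..}) (top_of_set {0..}) \<eta>"
  shows half_line_homeomorphism_nonneg: "\<And>t. 0 \<le> t \<Longrightarrow> 0 \<le> \<eta> t"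
    and half_line_homeomorphism_small: "\<And>e. 0 < e \<Longrightarrow> \<exists>r>0. \<forall>t. 0 < t \<and> t < r \<longrightarrow> \<eta> t < e"
proof -
  have cont: "continuous_on {0..} \<eta>" and img: "\<eta> ` {0..} = {0..}" and inj: "inj_on \<eta> {0..}"
    using homeomorphic_imp_continuous_map[OF hom] homeomorphic_imp_surjective_map[OF hom]
      homeomorphic_imp_injective_map[OF hom] by auto
  show nonneg: "0 \<le> \<eta> t" if "0 \<le> t" for t
    using img that by blast
  obtain u where u: "0 \<le> u" "\<eta> u = 0" using img by (metis atLeast_iff imageE order_refl)
  have "u = 0"
  proof (rule ccontr)
    assume "u \<noteq> 0"
    then have "0 < u" using u by simp
    then have "(\<eta> 0 < \<eta> u \<and> \<eta> u < \<eta> (u + 1)) \<or> (\<eta> (u + 1) < \<eta> u \<and> \<eta> u < \<eta> 0)"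
      by (intro continuous_inj_imp_mono continuous_on_subset[OF cont] inj_on_subset[OF inj]) auto
    then show False using u nonneg[of 0] nonneg[of "u + 1"] by auto
  qed
  then have "\<eta> 0 = 0" using u by simp
  then show "\<exists>r>0. \<forall>t. 0 < t \<and> t < r \<longrightarrow> \<eta> t < e" if e: "0 < e" for e
  proof -
    obtain r where "0 < r" "\<forall>t\<in>{0..}. dist t 0 < r \<longrightarrow> dist (\<eta> t) (\<eta> 0) < e"
      using cont[unfolded continuous_on_iff, rule_format, of 0 e] e by auto
    then show ?thesis
      using \<open>\<eta> 0 = 0\<close> by (intro exI[of _ r]) (auto simp: dist_real_def)
  qed
qed

text \<open>Replacing \<open>\<eta>\<close> by \<open>max 1 \<eta>\<close> on \<open>[1, \<infinity>)\<close> makes the distortion inequality hold for degenerate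
  triples as well: the case \<open>x = z\<close> can occur only for \<open>t \<ge> 1\<close>, and there the factor \<open>1\<close> suffices.\<close>

lemma quasisymmetric_control:
  fixes f :: "real \<Rightarrow> 'b"
  assumes qs: "quasisymmetric (submetric euclidean_metric E) m f"
  obtains \<psi> :: "real \<Rightarrow> real" where "\<And>t. 0 < t \<Longrightarrow> 0 \<le> \<psi> t"
    and "\<And>e. 0 < e \<Longrightarrow> \<exists>r>0. \<forall>t. 0 < t \<and> t < r \<longrightarrow> \<psi> t < e"
    and "\<And>t x y z. \<lbrakk>0 < t; x \<in> E; y \<in> E; z \<in> E; \<bar>x - y\<bar> \<le> t * \<bar>y - z\<bar>\<rbrakk>
           \<Longrightarrow> mdist m (f x) (f y) \<le> \<psi> t * mdist m (f y) (f z)"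
    and "f ` E \<subseteq> mspace m" and "inj_on f E"
proof -
  obtain \<eta> where hom: "homeomorphic_map (top_of_set {0..}) (top_of_set {0..}) \<eta>"
    and eta: "eta_quasisymmetric \<eta> (submetric euclidean_metric E) m f"
    using qs by (auto simp: quasisymmetric_def)
  have emb: "embedding_map (mtopology_of (submetric euclidean_metric E)) (mtopology_of m) f"
    using eta by (simp add: eta_quasisymmetric_def)
  have E: "topspace (mtopology_of (submetric euclidean_metric E)) = E"
    by (simp add: mspace_submetric)
  have img: "f ` E \<subseteq> mspace m"
    using emb E unfolding embedding_map_def
    by (metis homeomorphic_imp_surjective_map inf.cobounded1 topspace_mtopology_of topspace_subtopology)
  have inj: "inj_on f E"
    using emb E unfolding embedding_map_def by (metis homeomorphic_imp_injective_map)
  interpret Metric_space "mspace m" "mdist m" by simp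
  define \<psi> where "\<psi> t = (if t < 1 then \<eta> t else max 1 (\<eta> t))" for t
  have nonneg: "0 \<le> \<psi> t" if "0 < t" for t
    using half_line_homeomorphism_nonneg[OF hom, of t] that by (simp add: \<psi>_def max_def)
  have control: "mdist m (f x) (f y) \<le> \<psi> t * mdist m (f y) (f z)"
    if t: "0 < t" and mem: "x \<in> E" "y \<in> E" "z \<in> E" and le: "\<bar>x - y\<bar> \<le> t * \<bar>y - z\<bar>" for t x y z
  proof (cases "x = y")
    case True
    then show ?thesis using nonneg[OF t] img mem by auto
  next
    case False
    then have "y \<noteq> z" using le by auto
    show ?thesis
    proof (cases "x = z")
      case True
      then have "1 \<le> t" using le False by (simp add: abs_minus_commute)
      then have "1 * mdist m (f y) (f z) \<le> \<psi> t * mdist m (f y) (f z)"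
        by (intro mult_right_mono) (auto simp: \<psi>_def)
      then show ?thesis using True by (simp add: commute)
    next
      case neq: False
      have "mdist m (f x) (f y) / mdist m (f y) (f z) \<le> \<eta> t"
        using eta \<open>x \<noteq> y\<close> \<open>y \<noteq> z\<close> neq t mem le
        by (auto simp: eta_quasisymmetric_def mspace_submetric mdist_submetric dist_real_def divide_simps)
      moreover have "0 < mdist m (f y) (f z)"
        using \<open>y \<noteq> z\<close> img mem inj_onD[OF inj] by (intro mdist_pos_less) blast+
      ultimately have "mdist m (f x) (f y) \<le> \<eta> t * mdist m (f y) (f z)"
        by (simp add: divide_simps)
      also have "\<dots> \<le> \<psi> t * mdist m (f y) (f z)"
        by (intro mult_right_mono) (auto simp: \<psi>_def)
      finally show ?thesis .
    qed
  qed
  have small: "\<exists>r>0. \<forall>t. 0 < t \<and> t < r \<longrightarrow> \<psi> t < e" if "0 < e" for e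
  proof -
    from half_line_homeomorphism_small[OF hom that] obtain r
      where "0 < r" "\<forall>t. 0 < t \<and> t < r \<longrightarrow> \<eta> t < e" by blast
    then show ?thesis by (intro exI[of _ "min r 1"]) (auto simp: \<psi>_def)
  qed
  show ?thesis by (rule that[OF nonneg small control img inj])
qed

section \<open>Widths of cylinders under a quasisymmetric map\<close>

text \<open>A sum that reaches \<open>A\<close> up to a factor \<open>K\<close> does so without loss after passing to a power \<open>s < 1\<close>,
  provided each summand is a small fraction of \<open>A\<close>: the inequality
  \<open>B\<^sup>s = B\<^sup>s\<^sup>-\<^sup>1 B \<ge> (\<delta> A)\<^sup>s\<^sup>-\<^sup>1 B\<close> gains the factor \<open>\<delta>\<^sup>s\<^sup>-\<^sup>1\<close>, which absorbs \<open>K\<close>.\<close>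

lemma powr_subadditive_from_fine_split:
  fixes A K \<delta> s :: real and B :: "'i \<Rightarrow> real"
  assumes A: "0 < A" and B: "\<And>i. i \<in> I \<Longrightarrow> 0 < B i" "\<And>i. i \<in> I \<Longrightarrow> B i \<le> \<delta> * A"
    and sum: "A \<le> K * (\<Sum>i\<in>I. B i)" and s: "s < 1" and \<delta>: "0 < \<delta>" "K \<le> \<delta> powr (s - 1)"
  shows "A powr s \<le> (\<Sum>i\<in>I. B i powr s)"
proof -
  have split: "x powr s = x powr (s - 1) * x" if "0 < x" for x :: real
    using that by (simp add: powr_diff)
  have "A powr s \<le> A powr (s - 1) * (K * (\<Sum>i\<in>I. B i))"
    unfolding split[OF A] using sum by (intro mult_left_mono) auto
  also have "\<dots> \<le> A powr (s - 1) * (\<delta> powr (s - 1) * (\<Sum>i\<in>I. B i))"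
    using \<delta>(2) B(1) by (intro mult_left_mono mult_right_mono sum_nonneg) (auto simp: less_imp_le)
  also have "\<dots> = (\<delta> * A) powr (s - 1) * (\<Sum>i\<in>I. B i)"
    using A \<delta>(1) by (simp add: powr_mult)
  also have "\<dots> = (\<Sum>i\<in>I. (\<delta> * A) powr (s - 1) * B i)"
    by (rule sum_distrib_left)
  also have "\<dots> \<le> (\<Sum>i\<in>I. B i powr (s - 1) * B i)"
    using B s by (intro sum_mono mult_right_mono powr_mono2') (auto simp: less_imp_le)
  also have "\<dots> = (\<Sum>i\<in>I. B i powr s)"
    using B(1) by (intro sum.cong) (auto simp: split)
  finally show ?thesis .
qed

text \<open>A quasisymmetric map enters only through the metric \<open>d\<close> that it pulls back to the Cantor set and
  through a control function \<open>\<psi>\<close>.\<close>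

locale quasisymmetric_cantor = cantor_set +
  fixes d :: "real \<Rightarrow> real \<Rightarrow> real" and \<psi> :: "real \<Rightarrow> real"
  assumes d_nonneg: "0 \<le> d x y" and d_commute: "d x y = d y x"
    and d_pos: "\<lbrakk>x \<in> cantor M; y \<in> cantor M; x \<noteq> y\<rbrakk> \<Longrightarrow> 0 < d x y"
    and d_triangle: "\<lbrakk>x \<in> cantor M; y \<in> cantor M; z \<in> cantor M\<rbrakk> \<Longrightarrow> d x z \<le> d x y + d y z"
    and \<psi>_nonneg: "0 < t \<Longrightarrow> 0 \<le> \<psi> t"
    and control: "\<lbrakk>0 < t; x \<in> cantor M; y \<in> cantor M; z \<in> cantor M; \<bar>x - y\<bar> \<le> t * \<bar>y - z\<bar>\<rbrakk>
      \<Longrightarrow> d x y \<le> \<psi> t * d y z"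
begin

text \<open>The \<open>d\<close>-distance between the end points of a cylinder. It is easier to handle than the
  diameter, since the triangle inequality and \<open>control\<close> apply to it directly.\<close>

definition width :: "nat list \<Rightarrow> real" where
  "width w = d (word_map M w 0) (word_map M w (cantor_max M))"

lemma word_map_dist: "\<bar>word_map M w x - word_map M w y\<bar> = \<bar>x - y\<bar> / (2 * real M) ^ length w"
  by (simp add: word_map_diff abs_divide)

lemma cantor_max_fixed: "(2 * real (M - 1) + cantor_max M) / (2 * real M) = cantor_max M"
  using M by (simp add: cantor_max_def of_nat_diff divide_simps) (simp add: algebra_simps)

lemma width_pos:
  assumes "set w \<subseteq> {..<M}"
  shows "0 < width w"
proof -
  have "word_map M w 0 \<noteq> word_map M w (cantor_max M)"
    using word_map_dist[of w 0 "cantor_max M"] cantor_max_bounds M by auto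
  then show ?thesis
    unfolding width_def
    by (intro d_pos word_map_in_cantor zero_in_cantor cantor_max_in_cantor assms)
qed

text \<open>Walk from one end point to the other through the end points of the children. The gap in front of
  a child is at most twice as long as the child, so crossing it costs at most \<open>\<psi> 2\<close> times the width of
  the child; in particular the constant does not depend on \<open>M\<close>.\<close>

lemma width_le_sum_children:
  assumes w: "set w \<subseteq> {..<M}"
  shows "width w \<le> (1 + \<psi> 2) * (\<Sum>k<M. width (w @ [k]))"
proof -
  define p where "p k = word_map M (w @ [k]) 0" for k
  define q where "q k = word_map M (w @ [k]) (cantor_max M)" for k
  have mem: "p k \<in> cantor M" "q k \<in> cantor M" if "k < M" for k
    using that w unfolding p_def q_def
    by (auto intro!: word_map_in_cantor zero_in_cantor cantor_max_in_cantor)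
  have width: "width (w @ [k]) = d (p k) (q k)" for k
    by (simp add: width_def p_def q_def)
  have gap: "d (q k) (p (Suc k)) \<le> \<psi> 2 * width (w @ [Suc k])" if k: "Suc k < M" for k
    unfolding width
  proof (intro control mem)
    let ?r = "(2 * real M) ^ length w"
    have "\<bar>q k - p (Suc k)\<bar> = (2 - cantor_max M) / (2 * real M) / ?r"
      using cantor_max_bounds M unfolding p_def q_def
      by (simp add: word_map_append word_map_dist diff_divide_distrib[symmetric] abs_divide)
    also have "\<dots> \<le> 2 * cantor_max M / (2 * real M) / ?r"
      \<comment> \<open>The gap has relative length \<open>2 - cantor_max M \<le> 4 / 3 \<le> 2 * cantor_max M\<close>.\<close>
      using cantor_max_bounds by (intro divide_right_mono) auto
    also have "\<dots> = 2 * \<bar>p (Suc k) - q (Suc k)\<bar>"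
      using cantor_max_bounds unfolding p_def q_def word_map_dist by simp
    finally show "\<bar>q k - p (Suc k)\<bar> \<le> 2 * \<bar>p (Suc k) - q (Suc k)\<bar>" .
  qed (use k in auto)
  have chain: "d (p 0) (q j) \<le> (1 + \<psi> 2) * (\<Sum>k\<le>j. width (w @ [k]))" if "j < M" for j
    using that
  proof (induction j)
    case 0
    have "1 * width (w @ [0]) \<le> (1 + \<psi> 2) * width (w @ [0])"
      using \<psi>_nonneg[of 2] d_nonneg by (intro mult_right_mono) (auto simp: width)
    then show ?case by (simp add: width)
  next
    case (Suc j)
    have "d (p 0) (q (Suc j)) \<le> d (p 0) (q j) + d (q j) (q (Suc j))"
      using Suc.prems by (intro d_triangle mem) auto
    also have "d (q j) (q (Suc j)) \<le> d (q j) (p (Suc j)) + width (w @ [Suc j])"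
      unfolding width using Suc.prems by (intro d_triangle mem) auto
    also have "d (q j) (p (Suc j)) \<le> \<psi> 2 * width (w @ [Suc j])"
      by (rule gap[OF Suc.prems])
    finally show ?case
      using Suc by (simp add: algebra_simps)
  qed
  have "p 0 = word_map M w 0" "q (M - 1) = word_map M w (cantor_max M)"
    using cantor_max_fixed by (simp_all add: p_def q_def word_map_append)
  moreover have "{..M - 1} = {..<M}" using M by auto
  ultimately show ?thesis
    using chain[of "M - 1"] M by (simp add: width_def)
qed

text \<open>Compare the child first with the segment from its right end \<open>y\<close> to the farther end point \<open>z\<close> of
  the parent, which has at least a third of the scale of the parent, and then this segment with
  the parent itself. The first step provides the factor that tends to \<open>0\<close> as \<open>M\<close> grows.\<close>

lemma width_child_le:
  assumes w: "set w \<subseteq> {..<M}" and k: "k < M"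
  shows "width (w @ [k]) \<le> \<psi> (3 / (2 * real M)) * \<psi> 1 * width w"
proof -
  define y where "y = (2 * real k + cantor_max M) / (2 * real M)"
  have "2 * real k \<le> 2 * real (M - 1)" using k by simp
  then have "y \<le> (2 * real (M - 1) + cantor_max M) / (2 * real M)"
    unfolding y_def by (intro divide_right_mono) auto
  then have y: "0 \<le> y" "y \<le> cantor_max M"
    using cantor_max_bounds unfolding cantor_max_fixed by (auto simp: y_def)
  have q: "word_map M (w @ [k]) (cantor_max M) = word_map M w y"
    by (simp add: word_map_append y_def)
  have "y \<in> cantor M"
    using word_map_in_cantor[OF cantor_max_in_cantor, of "[k]"] k by (simp add: y_def)
  obtain z z' where z: "z \<in> {0, cantor_max M}" "z' \<in> {0, cantor_max M}" "z \<noteq> z'"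
    and far: "1 / 3 \<le> \<bar>y - z\<bar>" and near: "\<bar>y - z\<bar> \<le> \<bar>z - z'\<bar>"
  proof (cases "y \<le> cantor_max M / 2")
    case True
    then show ?thesis
      using y cantor_max_bounds by (intro that[of "cantor_max M" 0]) auto
  next
    case False
    then show ?thesis
      using y cantor_max_bounds by (intro that[of 0 "cantor_max M"]) auto
  qed
  have mem: "word_map M w x \<in> cantor M" if "x \<in> {y, 0, cantor_max M}" for x
    using that w \<open>y \<in> cantor M\<close> zero_in_cantor cantor_max_in_cantor
    by (auto intro!: word_map_in_cantor)
  have kmem: "word_map M (w @ [k]) 0 \<in> cantor M"
    using w k by (intro word_map_in_cantor zero_in_cantor) auto
  have "width (w @ [k]) \<le> \<psi> (3 / (2 * real M)) * d (word_map M w y) (word_map M w z)"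
    unfolding width_def q
  proof (intro control kmem mem)
    have "\<bar>word_map M (w @ [k]) 0 - word_map M w y\<bar> = cantor_max M / (2 * real M) / (2 * real M) ^ length w"
      using cantor_max_bounds unfolding q[symmetric] word_map_dist by simp
    also have "\<dots> \<le> (3 / (2 * real M) * \<bar>y - z\<bar>) / (2 * real M) ^ length w"
    proof (intro divide_right_mono)
      have "cantor_max M \<le> 3 * \<bar>y - z\<bar>" using far cantor_max_bounds(2) by simp
      then show "cantor_max M / (2 * real M) \<le> 3 / (2 * real M) * \<bar>y - z\<bar>"
        by (simp add: divide_right_mono)
    qed simp
    finally show "\<bar>word_map M (w @ [k]) 0 - word_map M w y\<bar>
        \<le> 3 / (2 * real M) * \<bar>word_map M w y - word_map M w z\<bar>"
      by (simp add: word_map_dist)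
  qed (use z M in auto)
  also have "d (word_map M w y) (word_map M w z) \<le> \<psi> 1 * d (word_map M w z) (word_map M w z')"
    using z near by (intro control mem) (auto simp: word_map_dist divide_right_mono)
  also have "d (word_map M w z) (word_map M w z') = width w"
    using z d_commute by (auto simp: width_def)
  finally show ?thesis
    using \<psi>_nonneg[of "3 / (2 * real M)"] M by (simp add: mult_left_mono mult.assoc)
qed

text \<open>An arbitrary set of \<open>d\<close>-diameter at most \<open>r\<close> may be replaced by one cylinder of comparable width.
  If it contains two points of the Cantor set, the smallest cylinder around it is split at a
  gap whose two sides it meets, and a gap is comparable to its cylinder, with a constant depending
  on \<open>M\<close>. If it contains at most one point, a deep cylinder of width at most \<open>e\<close> serves, because
  the widths decay geometrically.\<close>

lemma cylinder_hull:
  fixes X :: "real set"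
  assumes r: "\<And>x y. \<lbrakk>x \<in> X \<inter> cantor M; y \<in> X \<inter> cantor M\<rbrakk> \<Longrightarrow> d x y \<le> r"
    and contr: "\<psi> (3 / (2 * real M)) * \<psi> 1 \<le> \<delta>" "\<delta> < 1" and e: "0 < e"
  shows "\<exists>w. (\<forall>a\<in>digit_seqs M. digit_point M a \<in> X \<longrightarrow> map a [0..<length w] = w) \<and>
    (width w \<le> (2 * \<psi> (2 * real M) + 1) * r \<or> width w \<le> e)"
proof -
  define V where "V = {a \<in> digit_seqs M. digit_point M a \<in> X}"
  show ?thesis
  proof (cases "\<exists>n. \<exists>a\<in>V. \<exists>b\<in>V. a n \<noteq> b n")
    case True
    define n where "n = (LEAST n. \<exists>a\<in>V. \<exists>b\<in>V. a n \<noteq> b n)"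
    obtain a b where ab: "a \<in> V" "b \<in> V" "a n \<noteq> b n"
      using LeastI_ex[OF True] unfolding n_def[symmetric] by blast
    have agree: "a' i = a i" if "a' \<in> V" "i < n" for a' i
      using not_less_Least[of i "\<lambda>n. \<exists>a\<in>V. \<exists>b\<in>V. a n \<noteq> b n"] that ab(1)
      unfolding n_def by blast
    define w where "w = map a [0..<n]"
    have w: "length w = n" "set w \<subseteq> {..<M}"
      using ab by (auto simp: w_def V_def digit_seqs_def)
    have hull: "map a' [0..<length w] = w" if "a' \<in> V" for a'
      using agree[OF that] by (simp add: w_def)
    let ?A = "digit_point M a" and ?B = "digit_point M b"
    have AB: "?A \<in> X \<inter> cantor M" "?B \<in> X \<inter> cantor M"
      using ab by (auto simp: V_def cantor_def)
    have sep: "1 / (2 * real M) ^ Suc n \<le> \<bar>?A - ?B\<bar>"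
      using ab agree[OF ab(2)] by (intro digit_point_separation) (auto simp: V_def)
    let ?x = "digit_point M (\<lambda>i. a (i + n))"
    have A: "?A = word_map M w ?x"
      using ab digit_point_word by (simp add: V_def w_def)
    have "0 \<le> ?x" "?x \<le> 1"
      using ab digit_point_bounds[OF digit_seqs_shift] by (auto simp: V_def)
    then have x: "\<bar>z - ?x\<bar> \<le> 1" if "z \<in> {0, cantor_max M}" for z
      using that cantor_max_bounds by auto
    have half: "d (word_map M w z) ?A \<le> \<psi> (2 * real M) * r" if z: "z \<in> {0, cantor_max M}" for z
    proof -
      have "\<bar>word_map M w z - ?A\<bar> \<le> 1 / (2 * real M) ^ n"
        using x[OF z] unfolding A word_map_dist w(1) by (intro divide_right_mono) auto
      also have "\<dots> = 2 * real M * (1 / (2 * real M) ^ Suc n)"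
        using M by simp
      also have "\<dots> \<le> 2 * real M * \<bar>?A - ?B\<bar>"
        using sep by (intro mult_left_mono) auto
      finally have "d (word_map M w z) ?A \<le> \<psi> (2 * real M) * d ?A ?B"
        using M z AB w by (intro control) (auto intro!: word_map_in_cantor zero_in_cantor cantor_max_in_cantor)
      also have "\<dots> \<le> \<psi> (2 * real M) * r"
        using r[OF AB] \<psi>_nonneg[of "2 * real M"] M by (intro mult_left_mono) auto
      finally show ?thesis .
    qed
    have "width w \<le> d (word_map M w 0) ?A + d ?A (word_map M w (cantor_max M))"
      unfolding width_def using w AB
      by (intro d_triangle word_map_in_cantor zero_in_cantor cantor_max_in_cantor) auto
    also have "\<dots> \<le> 2 * \<psi> (2 * real M) * r"
      using half[of 0] half[of "cantor_max M"] d_commute by simp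
    also have "\<dots> \<le> (2 * \<psi> (2 * real M) + 1) * r"
      using r[OF AB] d_nonneg[of ?A ?B] by (intro mult_right_mono) linarith+
    finally show ?thesis
      using hull unfolding V_def by blast
  next
    case False
    obtain a where a: "a \<in> digit_seqs M" "V \<subseteq> {a}"
    proof (cases "V = {}")
      case True
      then show ?thesis using M by (intro that[of "\<lambda>_. 0"]) (auto simp: digit_seqs_def)
    next
      case nonempty: False
      then obtain a where "a \<in> V" by blast
      with False show ?thesis by (intro that[of a]) (auto simp: V_def fun_eq_iff)
    qed
    have "0 \<le> \<psi> (3 / (2 * real M)) * \<psi> 1"
      using M \<psi>_nonneg by (intro mult_nonneg_nonneg) auto
    then have \<delta>: "0 \<le> \<delta>" using contr by linarith
    have prefixes: "set (map a [0..<n]) \<subseteq> {..<M}" for n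
      using a(1) by (auto simp: digit_seqs_def)
    have decay: "width (map a [0..<n]) \<le> \<delta> ^ n * width []" for n
    proof (induction n)
      case (Suc n)
      have "width (map a [0..<Suc n]) \<le> \<psi> (3 / (2 * real M)) * \<psi> 1 * width (map a [0..<n])"
        using width_child_le[OF prefixes, of "a n" n] a(1) by (simp add: digit_seqs_def)
      also have "\<dots> \<le> \<delta> * width (map a [0..<n])"
        using contr d_nonneg by (intro mult_right_mono) (auto simp: width_def)
      also have "\<dots> \<le> \<delta> * (\<delta> ^ n * width [])"
        using \<delta> Suc by (intro mult_left_mono)
      finally show ?case by simp
    qed simp
    have "(\<lambda>n. \<delta> ^ n * width []) \<longlonglongrightarrow> 0 * width []"
      using \<delta> contr by (intro tendsto_mult LIMSEQ_power_zero tendsto_const) auto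
    then have "eventually (\<lambda>n. \<delta> ^ n * width [] < e) sequentially"
      using e by (simp add: order_tendsto_iff)
    then obtain n where "\<delta> ^ n * width [] < e"
      unfolding eventually_sequentially by blast
    then have "width (map a [0..<n]) \<le> e"
      using decay[of n] by linarith
    then show ?thesis
      using a(2) by (intro exI[of _ "map a [0..<n]"]) (auto simp: V_def)
  qed
qed

text \<open>The powers of the widths satisfy the hypothesis of \<open>word_cover_sum_ge\<close>, so the cylinders that replace
  the members of a cover have a total weight bounded below. The errors made for members with at most
  one point are summable and arbitrarily small.\<close>

lemma cover_sum_lower_bound:
  assumes s: "0 < s" "s < 1"
    and \<delta>: "\<psi> (3 / (2 * real M)) * \<psi> 1 \<le> \<delta>" "0 < \<delta>" "\<delta> < 1" "1 + \<psi> 2 \<le> \<delta> powr (s - 1)"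
    and cover: "cantor M \<subseteq> (\<Union>i. X i)"
    and r: "\<And>i x y. \<lbrakk>x \<in> X i \<inter> cantor M; y \<in> X i \<inter> cantor M\<rbrakk> \<Longrightarrow> d x y \<le> r i"
    and r_nonneg: "\<And>i. 0 \<le> r i"
  shows "ennreal ((width [] / (2 * \<psi> (2 * real M) + 1)) powr s) \<le> (\<Sum>i. ennreal (r i powr s))"
proof (rule ennreal_le_epsilon)
  let ?C = "2 * \<psi> (2 * real M) + 1"
  have C: "0 < ?C" using \<psi>_nonneg[of "2 * real M"] M by simp
  fix e :: real assume e: "0 < e"
  define e' where "e' i = e * (1 / 2) ^ Suc i" for i :: nat
  have e': "0 < e' i" for i using e by (simp add: e'_def)
  have "\<exists>w. (\<forall>a\<in>digit_seqs M. digit_point M a \<in> X i \<longrightarrow> map a [0..<length w] = w) \<and>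
      (width w / ?C) powr s \<le> r i powr s + e' i" for i
  proof -
    have "0 < ?C * e' i powr (1 / s)" using C e'[of i] by simp
    from cylinder_hull[of "X i" "r i", OF r \<delta>(1,3) this] obtain w
      where w: "\<forall>a\<in>digit_seqs M. digit_point M a \<in> X i \<longrightarrow> map a [0..<length w] = w"
        and "width w \<le> ?C * r i \<or> width w \<le> ?C * e' i powr (1 / s)" by blast
    then have "width w / ?C \<le> r i \<or> width w / ?C \<le> e' i powr (1 / s)"
      using C by (simp add: pos_divide_le_eq mult.commute)
    moreover have nn: "0 \<le> width w / ?C" using C d_nonneg by (simp add: width_def)
    ultimately have "(width w / ?C) powr s \<le> r i powr s \<or> (width w / ?C) powr s \<le> (e' i powr (1 / s)) powr s"
      using s by (meson less_imp_le powr_mono2)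
    moreover have "(e' i powr (1 / s)) powr s = e' i"
      using s e'[of i] by (simp add: powr_powr)
    ultimately have "(width w / ?C) powr s \<le> r i powr s + e' i"
      using e'[of i] powr_ge_zero[of "r i" s] by linarith
    then show ?thesis using w by blast
  qed
  then obtain c where c: "\<And>i a. \<lbrakk>a \<in> digit_seqs M; digit_point M a \<in> X i\<rbrakk> \<Longrightarrow> map a [0..<length (c i)] = c i"
    and c_le: "\<And>i. (width (c i) / ?C) powr s \<le> r i powr s + e' i" by metis
  have "ennreal ((width [] / ?C) powr s) \<le> (\<Sum>i. ennreal ((width (c i) / ?C) powr s))"
  proof (rule word_cover_sum_ge)
    fix w assume w: "set w \<subseteq> {..<M}"
    have "(width w / ?C) powr s \<le> (\<Sum>k<M. (width (w @ [k]) / ?C) powr s)"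
    proof (rule powr_subadditive_from_fine_split[where \<delta> = \<delta> and K = "1 + \<psi> 2"])
      have pos: "0 < width (w @ [k])" if "k < M" for k
        using w that by (intro width_pos) auto
      show "0 < width w / ?C" using width_pos[OF w] C by simp
      show "0 < width (w @ [k]) / ?C" if "k \<in> {..<M}" for k
        using pos that C by simp
      show "width (w @ [k]) / ?C \<le> \<delta> * (width w / ?C)" if "k \<in> {..<M}" for k
      proof -
        have "width (w @ [k]) \<le> \<delta> * width w"
          using width_child_le[OF w, of k] mult_right_mono[OF \<delta>(1) less_imp_le[OF width_pos[OF w]]] that
          by simp
        then show ?thesis using C by (simp add: divide_right_mono)
      qed
      show "width w / ?C \<le> (1 + \<psi> 2) * (\<Sum>k<M. width (w @ [k]) / ?C)"
        using width_le_sum_children[OF w] C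
        by (simp add: divide_right_mono sum_divide_distrib[symmetric])
    qed (use s \<delta> in auto)
    then show "ennreal ((width w / ?C) powr s) \<le> (\<Sum>k<M. ennreal ((width (w @ [k]) / ?C) powr s))"
      by (simp add: sum_ennreal ennreal_leI)
  next
    fix a assume a: "a \<in> digit_seqs M"
    then obtain i where "digit_point M a \<in> X i" using cover by (auto simp: cantor_def)
    then show "\<exists>i n. map a [0..<n] = c i" using c[OF a] by blast
  qed
  also have "\<dots> \<le> (\<Sum>i. ennreal (r i powr s) + ennreal (e' i))"
    using c_le e' by (intro suminf_le) (auto simp: ennreal_plus[symmetric] less_imp_le simp del: ennreal_plus intro!: ennreal_leI)
  also have "\<dots> = (\<Sum>i. ennreal (r i powr s)) + (\<Sum>i. ennreal (e' i))"
    by (intro suminf_add[symmetric]) auto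
  also have "(\<Sum>i. ennreal (e' i)) = ennreal e"
  proof -
    have "e' sums (e * 1)" unfolding e'_def by (intro sums_mult power_half_series)
    then show ?thesis
      using less_imp_le[OF e'] by (intro suminf_ennreal_eq) simp_all
  qed
  finally show "ennreal ((width [] / ?C) powr s) \<le> (\<Sum>i. ennreal (r i powr s)) + ennreal e" .
qed

end

section \<open>The dimension of quasisymmetric images\<close>

text \<open>Given the map and \<open>s < 1\<close>, a contraction factor \<open>\<delta>\<close> is determined by \<open>\<psi> 2\<close> and \<open>s\<close> alone, and then a
  Cantor set with \<open>M\<close> large enough for \<open>\<psi> (3 / (2M)) * \<psi> 1 \<le> \<delta>\<close> is chosen in the family. This is
  why one Cantor set is not enough: the required \<open>M\<close> depends on the map and on \<open>s\<close>.\<close>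

lemma hausdorff_measure_image_cantor_family:
  fixes m :: "'b metric" and f :: "real \<Rightarrow> 'b"
  assumes qs: "quasisymmetric (submetric euclidean_metric E) m f"
    and family: "\<And>n. \<exists>M\<ge>n. 2 \<le> M \<and> cantor M \<subseteq> E"
    and s: "0 < s" "s < 1"
  shows "hausdorff_measure m s (f ` E) \<noteq> 0"
proof
  assume zero: "hausdorff_measure m s (f ` E) = 0"
  obtain \<psi> where \<psi>_nonneg: "\<And>t. 0 < t \<Longrightarrow> 0 \<le> \<psi> t"
    and \<psi>_small: "\<And>e. 0 < e \<Longrightarrow> \<exists>r>0. \<forall>t. 0 < t \<and> t < r \<longrightarrow> \<psi> t < e"
    and control: "\<And>t x y z. \<lbrakk>0 < t; x \<in> E; y \<in> E; z \<in> E; \<bar>x - y\<bar> \<le> t * \<bar>y - z\<bar>\<rbrakk>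
           \<Longrightarrow> mdist m (f x) (f y) \<le> \<psi> t * mdist m (f y) (f z)"
    and img: "f ` E \<subseteq> mspace m" and inj: "inj_on f E"
    by (rule quasisymmetric_control[OF qs]) blast
  \<comment> \<open>The base \<open>2 + \<psi> 2\<close> in place of the needed \<open>1 + \<psi> 2\<close> guarantees \<open>\<delta> < 1\<close>.\<close>
  define \<delta> where "\<delta> = (2 + \<psi> 2) powr (1 / (s - 1))"
  have "1 < 2 + \<psi> 2" using \<psi>_nonneg[of 2] by simp
  then have "\<delta> < (2 + \<psi> 2) powr 0"
    unfolding \<delta>_def using s by (intro powr_less_mono) (auto simp: divide_simps)
  then have \<delta>: "0 < \<delta>" "\<delta> < 1" using \<open>1 < 2 + \<psi> 2\<close> by (auto simp: \<delta>_def)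
  have "\<delta> powr (s - 1) = 2 + \<psi> 2"
    unfolding \<delta>_def powr_powr using s \<open>1 < 2 + \<psi> 2\<close> by simp
  then have \<delta>_K: "1 + \<psi> 2 \<le> \<delta> powr (s - 1)" by simp
  have \<psi>1: "0 \<le> \<psi> 1" by (simp add: \<psi>_nonneg)
  then obtain \<rho> where \<rho>: "0 < \<rho>" "\<And>t. \<lbrakk>0 < t; t < \<rho>\<rbrakk> \<Longrightarrow> \<psi> t < \<delta> / (\<psi> 1 + 1)"
    using \<psi>_small[of "\<delta> / (\<psi> 1 + 1)"] \<delta> by auto
  obtain n :: nat where "3 / \<rho> < real n" using reals_Archimedean2 by blast
  with family[of n] obtain M where M: "2 \<le> M" "3 / \<rho> < real M" and sub: "cantor M \<subseteq> E"
    by (metis le_trans less_le_trans of_nat_le_iff)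
  have "3 < real M * \<rho>" using M(2) \<rho>(1) by (simp add: pos_divide_less_eq)
  then have "3 / (2 * real M) < \<rho>" using M(1) by (simp add: field_simps)
  then have "\<psi> (3 / (2 * real M)) \<le> \<delta> / (\<psi> 1 + 1)"
    using M(1) by (intro less_imp_le \<rho>) auto
  then have "\<psi> (3 / (2 * real M)) * \<psi> 1 \<le> \<delta> / (\<psi> 1 + 1) * \<psi> 1"
    using \<psi>1 by (rule mult_right_mono)
  also have "\<dots> \<le> \<delta>"
    using \<psi>1 \<delta> by (simp add: divide_simps algebra_simps)
  finally have contr: "\<psi> (3 / (2 * real M)) * \<psi> 1 \<le> \<delta>" .
  interpret Y: Metric_space "mspace m" "mdist m" by simp
  have in_m: "f x \<in> mspace m" if "x \<in> cantor M" for x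
    using that sub img by blast
  interpret quasisymmetric_cantor M "\<lambda>x y. mdist m (f x) (f y)" \<psi>
  proof
    fix x y assume "x \<in> cantor M" "y \<in> cantor M" "x \<noteq> y"
    then show "0 < mdist m (f x) (f y)"
      using inj_onD[OF inj, of x y] sub by (intro Y.mdist_pos_less in_m) blast+
  next
    fix t x y z
    assume "0 < t" "x \<in> cantor M" "y \<in> cantor M" "z \<in> cantor M" "\<bar>x - y\<bar> \<le> t * \<bar>y - z\<bar>"
    then show "mdist m (f x) (f y) \<le> \<psi> t * mdist m (f y) (f z)"
      using sub by (intro control) auto
  qed (use M(1) \<psi>_nonneg in_m in \<open>auto simp: mdist_commute intro: Y.triangle\<close>)
  let ?\<kappa> = "(width [] / (2 * \<psi> (2 * real M) + 1)) powr s"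
  have "0 < ?\<kappa>"
    using width_pos[of "[]"] \<psi>_nonneg[of "2 * real M"] M(1) by simp
  have "hausdorff_premeasure m s 1 (f ` E) \<le> hausdorff_measure m s (f ` E)"
    unfolding hausdorff_measure_def by (intro SUP_upper) simp
  then have "hausdorff_premeasure m s 1 (f ` E) < ennreal ?\<kappa>"
    using zero \<open>0 < ?\<kappa>\<close> by simp
  then obtain U where U: "\<And>i. mdiam m (U i) \<le> ennreal 1" "f ` E \<subseteq> (\<Union>i. U i)"
    and less: "(\<Sum>i. ennreal (enn2real (mdiam m (U i)) powr s)) < ennreal ?\<kappa>"
    unfolding hausdorff_premeasure_def INF_less_iff by blast
  have "mdist m u v \<le> enn2real (mdiam m (U i))" if "u \<in> U i" "v \<in> U i" for i u v
  proof -
    have "ennreal (mdist m u v) \<le> mdiam m (U i)"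
      unfolding mdiam_def by (rule SUP_upper2[OF that(1)], rule SUP_upper[OF that(2)])
    moreover have "mdiam m (U i) < top"
      using U(1)[of i] by (metis ennreal_less_top le_less_trans)
    ultimately show ?thesis
      by (metis enn2real_ennreal enn2real_mono mdist_nonneg)
  qed
  moreover have "cantor M \<subseteq> f -` (\<Union>i. U i)" using U(2) sub by blast
  ultimately have "ennreal ?\<kappa> \<le> (\<Sum>i. ennreal (enn2real (mdiam m (U i)) powr s))"
    unfolding vimage_UN
    by (intro cover_sum_lower_bound[OF s contr \<delta> \<delta>_K, where X = "\<lambda>i. f -` U i"]) auto
  with less show False by simp
qed

lemma quasisymmetric_id: "quasisymmetric m m id"
proof -
  have "embedding_map (mtopology_of m) (mtopology_of m) id"
    using subtopology_topspace[of "mtopology_of m"] by (simp add: embedding_map_def)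
  then have "eta_quasisymmetric id m m id"
    by (simp add: eta_quasisymmetric_def)
  then show ?thesis
    unfolding quasisymmetric_def by (intro exI[of _ id]) simp
qed

text \<open>Covering by \<open>n\<close> intervals of length \<open>1 / n\<close> gives the bound \<open>n\<^sup>1\<^sup>-\<^sup>s\<close>, which tends to \<open>0\<close>.\<close>

lemma hausdorff_measure_unit_interval_subset:
  fixes E :: "real set"
  assumes E: "E \<subseteq> {0..1}" and s: "1 < s"
  shows "hausdorff_measure (submetric euclidean_metric E) s E = 0"
proof -
  let ?m = "submetric euclidean_metric E"
  have "hausdorff_premeasure ?m s \<delta> E \<le> 0" if \<delta>: "0 < \<delta>" for \<delta>
  proof (rule LIMSEQ_le_const)
    show "(\<lambda>n. ennreal (real (Suc n) * (1 / real (Suc n)) powr s)) \<longlonglongrightarrow> 0"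
    proof -
      have "(\<lambda>n. real (Suc n) * (1 / real (Suc n)) powr s) = (\<lambda>n. real (Suc n) powr (1 - s))"
        by (simp add: fun_eq_iff powr_diff powr_divide)
      moreover have "(\<lambda>n. real (Suc n) powr (1 - s)) \<longlonglongrightarrow> 0"
        using s by (intro tendsto_neg_powr filterlim_compose[OF filterlim_real_sequentially filterlim_Suc]) simp
      ultimately show ?thesis
        using tendsto_ennrealI[of _ 0 sequentially] by (metis ennreal_0)
    qed
    obtain N :: nat where N: "1 / \<delta> < real N" using reals_Archimedean2 by blast
    have "hausdorff_premeasure ?m s \<delta> E \<le> ennreal (real (Suc n) * (1 / real (Suc n)) powr s)"
      if "N \<le> n" for n
    proof -
      let ?l = "1 / real (Suc n)"
      define U where "U i = (if i < Suc n then E \<inter> {real i * ?l .. real (Suc i) * ?l} else {})" for i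
      have diam: "mdiam ?m (U i) \<le> ennreal ?l" for i
        unfolding mdiam_def
      proof (intro SUP_least ennreal_leI)
        fix x y assume "x \<in> U i" "y \<in> U i"
        then have "x \<in> {real i * ?l .. real (Suc i) * ?l}" "y \<in> {real i * ?l .. real (Suc i) * ?l}"
          by (auto simp: U_def split: if_splits)
        then show "mdist ?m x y \<le> ?l"
          by (auto simp: mdist_submetric dist_real_def abs_le_iff distrib_right add_divide_distrib)
      qed
      have "1 / \<delta> < real (Suc n)" using N that by linarith
      then have "?l \<le> \<delta>" using \<delta> by (simp add: field_simps)
      then have "mdiam ?m (U i) \<le> ennreal \<delta>" for i
        using diam[of i] ennreal_leI order_trans by blast
      moreover have "E \<subseteq> (\<Union>i. U i)"
      proof
        fix x assume x: "x \<in> E"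
        show "x \<in> (\<Union>i. U i)"
        proof (cases "x = 1")
          case True
          then have "x \<in> U n" using x by (simp add: U_def)
          then show ?thesis by blast
        next
          case False
          define i where "i = nat \<lfloor>x * real (Suc n)\<rfloor>"
          have "0 \<le> x" "x < 1" using False E x by auto
          then have fl: "real i \<le> x * real (Suc n)" "x * real (Suc n) < real i + 1"
            unfolding i_def by auto
          have "x * real (Suc n) < 1 * real (Suc n)"
            using \<open>x < 1\<close> by (intro mult_strict_right_mono) auto
          with fl(1) have "real i < real (Suc n)"
            unfolding mult_1 by (rule le_less_trans)
          then have "x \<in> U i" using fl x by (simp add: U_def field_simps)
          then show ?thesis by blast
        qed
      qed
      ultimately have "U \<in> {U. (\<forall>i. U i \<subseteq> mspace ?m \<and> mdiam ?m (U i) \<le> ennreal \<delta>) \<and> E \<subseteq> (\<Union>i. U i)}"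
        by (auto simp: U_def mspace_submetric)
      then have "hausdorff_premeasure ?m s \<delta> E \<le> (\<Sum>i. ennreal (enn2real (mdiam ?m (U i)) powr s))"
        unfolding hausdorff_premeasure_def by (rule INF_lower)
      also have "\<dots> = (\<Sum>i<Suc n. ennreal (enn2real (mdiam ?m (U i)) powr s))"
        by (intro suminf_finite) (auto simp: U_def mdiam_def bot_ennreal)
      also have "\<dots> \<le> (\<Sum>i<Suc n. ennreal (?l powr s))"
      proof (intro sum_mono ennreal_leI powr_mono2)
        show "enn2real (mdiam ?m (U i)) \<le> ?l" for i
          by (intro enn2real_leI diam) simp
      qed (use s in auto)
      also have "\<dots> = ennreal (real (Suc n) * ?l powr s)"
        by (subst sum_ennreal) (simp_all del: of_nat_Suc)
      finally show ?thesis .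
    qed
    then show "\<exists>N. \<forall>n\<ge>N. hausdorff_premeasure ?m s \<delta> E \<le> ennreal (real (Suc n) * (1 / real (Suc n)) powr s)"
      by (intro exI[of _ N] allI impI)
  qed
  then have "hausdorff_measure ?m s E \<le> 0"
    unfolding hausdorff_measure_def by (intro SUP_least) simp
  then show ?thesis by simp
qed

theorem theorem1p1:
  shows "\<exists>E :: real set. E \<in> null_sets lebesgue \<and>
           conformal_dim (submetric euclidean_metric E) = 1"
proof -
  define E where "E = (\<Union>M. cantor (M + 2))"
  let ?m = "submetric euclidean_metric E"
  have cantor: "cantor_set (M + 2)" for M by unfold_locales simp
  have "E \<in> null_sets lebesgue"
    unfolding E_def using cantor_set.null_cantor[OF cantor] by (intro null_sets_UN) auto
  moreover have "conformal_dim ?m \<le> 1"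
  proof -
    have E01: "E \<subseteq> {0..1}" using cantor_set.cantor_subset[OF cantor] by (auto simp: E_def)
    have "conformal_dim ?m \<le> hausdorff_dim ?m E"
      using conformal_dim_le[OF quasisymmetric_id, of ?m] by (simp add: mspace_submetric)
    also have "\<dots> \<le> 1"
    proof (rule ennreal_le_epsilon)
      fix e :: real assume "0 < e"
      then have "hausdorff_dim ?m E \<le> ennreal (1 + e)"
        unfolding hausdorff_dim_def
        by (intro Inf_lower CollectI exI[of _ "1 + e"] conjI refl
            hausdorff_measure_unit_interval_subset[OF E01]) auto
      then show "hausdorff_dim ?m E \<le> 1 + ennreal e"
        using \<open>0 < e\<close> by (simp add: ennreal_plus)
    qed
    finally show ?thesis .
  qed
  moreover have "1 \<le> conformal_dim ?m"
    unfolding conformal_dim_def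
  proof (rule Inf_greatest, safe)
    fix m' :: "real metric" and f :: "real \<Rightarrow> real"
    assume qs: "quasisymmetric ?m m' f"
    have family: "\<exists>M\<ge>n. 2 \<le> M \<and> cantor M \<subseteq> E" for n
      by (intro exI[of _ "n + 2"]) (auto simp: E_def)
    show "1 \<le> hausdorff_dim m' (f ` mspace ?m)"
      unfolding hausdorff_dim_def
    proof (rule Inf_greatest, safe)
      fix s :: real
      assume "0 < s" "hausdorff_measure m' s (f ` mspace ?m) = 0"
      then have "1 \<le> s"
        using hausdorff_measure_image_cantor_family[OF qs family, of s]
        by (force simp: mspace_submetric not_less[symmetric])
      then show "1 \<le> ennreal s"
        by (metis ennreal_1 ennreal_leI)
    qed
  qed
  ultimately show ?thesis by (intro exI[of _ E]) (simp add: antisym)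
qed

end
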